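(* Let $K$ be a field and $n\ge 2$. Let $I\subset K[x,y]$ be an ideal minimally generated by $n$ monomials listed lexicographically, $$I=(x^{a_1},\, x^{a_2}y^{b_{n-1}},\ldots,x^{a_i}y^{b_{n-i+1}},\ldots, x^{a_{n-1}}y^{b_2},\, y^{b_1}),$$ where $a_1>a_2>\cdots>a_{n-1}>a_n:=0$ and $b_1>b_2>\cdots>b_{n-1}>b_n:=0$ are integers. If $I$ is normal, then there exists an integer $k$, $1\le k\le n$, such that: (1) $a_j=n-j$ for $k\le j\le n-1$ (that is, $a_{n-1}=1$, $a_{n-2}=2$, ..., $a_k=n-k$); (2) $b_j=n-j$ for $n-k+1\le j\le n-1$ (that is, $b_{n-1}=1$, $b_{n-2}=2$, ..., $b_{n-k+1}=k-1$); (3) $b_j\le\left\lceil\frac{b_{j-1}+b_{j+1}}{2}\right\rceil$ for $2\le j\le n-k$; (4) $a_j\le\left\lceil\frac{a_{j-1}+a_{j+1}}{2}\right\rceil$ for $2\le j\le k-1$.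
   Context: An ideal $I$ is normal if all its powers $I^m$, $m\ge1$, are integrally closed. $\lceil r\rceil$ denotes the ceiling of a real number $r$. Conditions with an empty range of indices are vacuous. *)

theory Defs
  imports Complex_Main "HOL-Library.Poly_Mapping" "HOL-Library.Product_Plus"
begin

(* Regarding a commutative ring as a module over itself, its submodules are its ideals:
   ideal.span S is the ideal generated by S, and ideal.subspace I says that I is an ideal. *)
global_interpretation ideal: module "(*) :: 'r \<Rightarrow> 'r \<Rightarrow> 'r::comm_ring_1"
  by unfold_locales (simp_all add: algebra_simps)

definition ideal_mult :: "'r::comm_ring_1 set \<Rightarrow> 'r set \<Rightarrow> 'r set" where
  "ideal_mult I J = ideal.span {u * v | u v. u \<in> I \<and> v \<in> J}"

primrec ideal_power :: "'r::comm_ring_1 set \<Rightarrow> nat \<Rightarrow> 'r set" where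
  "ideal_power I 0 = UNIV"
| "ideal_power I (Suc m) = ideal_mult I (ideal_power I m)"

definition integral_over_ideal :: "'r::comm_ring_1 \<Rightarrow> 'r set \<Rightarrow> bool" where
  "integral_over_ideal r I \<longleftrightarrow>
     (\<exists>d\<ge>1. \<exists>c. (\<forall>i\<in>{1..d}. c i \<in> ideal_power I i) \<and>
        r ^ d + (\<Sum>i = 1..d. c i * r ^ (d - i)) = 0)"

definition ideal_integral_closure :: "'r::comm_ring_1 set \<Rightarrow> 'r set" where
  "ideal_integral_closure I = {r. integral_over_ideal r I}"

definition integrally_closed_ideal :: "'r::comm_ring_1 set \<Rightarrow> bool" where
  "integrally_closed_ideal I \<longleftrightarrow> ideal_integral_closure I = I"

definition normal_ideal :: "'r::comm_ring_1 set \<Rightarrow> bool" where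
  "normal_ideal I \<longleftrightarrow> ideal.subspace I \<and> (\<forall>m\<ge>1. integrally_closed_ideal (ideal_power I m))"

definition minimally_generates :: "'r::comm_ring_1 set \<Rightarrow> 'r set \<Rightarrow> bool" where
  "minimally_generates G I \<longleftrightarrow> ideal.span G = I \<and> (\<forall>H. H \<subset> G \<longrightarrow> ideal.span H \<noteq> I)"

(* K[x,y] as the monoid algebra of pairs of exponents: the coefficient of x^i y^j in p is
   lookup p (i, j), and multiplication is convolution. *)
type_synonym 'k poly_xy = "nat \<times> nat \<Rightarrow>\<^sub>0 'k"

definition monom_xy :: "nat \<Rightarrow> nat \<Rightarrow> 'k::field poly_xy" where
  "monom_xy i j = Poly_Mapping.single (i, j) 1"

end

theory Submission
  imports Defs
begin

text \<open>Write \<open>P\<^sub>i = (a\<^sub>i, c\<^sub>i)\<close> with \<open>c\<^sub>i = b\<^bsub>n-i+1\<^esub>\<close> for the exponents of the generators: the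
  corners of a staircase, along which \<open>a\<close> falls and \<open>c\<close> rises. If a lattice point \<open>Q\<close> dominates a
  rational convex combination of two corners, then some power \<open>u\<^sup>d\<close> of its monomial \<open>u\<close> lies in
  \<open>I\<^sup>d\<close>, so that \<open>u\<close> is integral over \<open>I\<close>. Since \<open>I\<close> itself is integrally closed, \<open>u \<in> I\<close>, and so
  \<open>Q\<close> already dominates a corner. This lattice convexity (lemma \<open>normal_monomial_ideal_convex\<close>,
  abstracted in the locale \<open>convex_staircase\<close>) turns the claim into plane geometry.

  Call the move from \<open>P\<^sub>i\<close> to \<open>P\<^bsub>i+1\<^esub>\<close> the step \<open>i\<close>. A step that is long in the \<open>x\<close>-direction
  (\<open>a\<^sub>j - a\<^bsub>j+1\<^esub> \<ge> 2\<close>) cannot come after, or coincide with, one that is long in the \<open>y\<close>-direction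
  (\<open>c\<^bsub>i+1\<^esub> - c\<^sub>i \<ge> 2\<close>). Otherwise choose such \<open>i \<le> j\<close> with \<open>i\<close> as large as possible: the lattice
  point \<open>(a\<^sub>i - 1, c\<^bsub>i+1\<^esub> - 1)\<close> dominates no corner, and yet it lies on or above the segment from
  \<open>P\<^sub>i\<close> to \<open>P\<^bsub>j+1\<^esub>\<close> (lemma \<open>rise_eq_Suc_before_long_run\<close>). Let \<open>k - 1\<close> be the last step that is long
  in the \<open>x\<close>-direction, or \<open>k = 1\<close> if there is none. After it \<open>a\<close> falls by one at each step, which
  gives (1), and up to it \<open>c\<close> rises by one at each step, which gives (2).

  Where three corners are equally spaced in one coordinate, the midpoint of the outer two, with its
  other coordinate rounded up, is a lattice point level with the middle corner; convexity then bounds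
  the middle corner, which gives (3) and (4).\<close>


section \<open>Powers of ideals and integral elements\<close>

lemma subspace_ideal_power: "ideal.subspace (ideal_power I m)"
  by (cases m) (simp_all add: ideal_mult_def ideal.subspace_UNIV ideal.subspace_span)

lemma ideal_power_one:
  fixes I :: "'a::comm_ring_1 set"
  assumes "ideal.subspace I"
  shows "ideal_power I 1 = I"
proof -
  have "{u * v | u v. u \<in> I \<and> v \<in> UNIV} = I"
  proof
    have "u * v \<in> I" if "u \<in> I" for u v
      using ideal.subspace_scale[OF assms that, of v] by (simp only: mult.commute)
    then show "{u * v | u v. u \<in> I \<and> v \<in> UNIV} \<subseteq> I" by blast
    show "I \<subseteq> {u * v | u v. u \<in> I \<and> v \<in> UNIV}"
    proof
      fix u assume "u \<in> I"
      then have "u = u * 1 \<and> u \<in> I \<and> (1 :: 'a) \<in> UNIV" by simp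
      then show "u \<in> {u * v | u v. u \<in> I \<and> v \<in> UNIV}" by blast
    qed
  qed
  then show ?thesis
    using ideal.span_eq_iff[of I] assms by (simp add: ideal_mult_def)
qed

lemma power_mult_mem_ideal_power:
  assumes "f \<in> I" and "g \<in> ideal_power I t"
  shows "f ^ s * g \<in> ideal_power I (s + t)"
proof (induction s)
  case (Suc s)
  have "f * (f ^ s * g) \<in> ideal_power I (Suc (s + t))"
    unfolding ideal_power.simps ideal_mult_def
    using assms(1) Suc.IH by (intro ideal.span_base) blast
  then show ?case by simp
qed (use assms in simp)

text \<open>The equation of integral dependence is \<open>X\<^sup>d - r\<^sup>d = 0\<close>.\<close>
lemma integral_over_ideal_of_power_mem:
  assumes "d \<ge> 1" and "r ^ d \<in> ideal_power I d"
  shows "integral_over_ideal r I"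
proof -
  define c where "c i = (if i = d then - (r ^ d) else 0)" for i
  have "c i \<in> ideal_power I i" for i
    using ideal.subspace_neg[OF subspace_ideal_power assms(2)]
    by (simp add: c_def ideal.subspace_0[OF subspace_ideal_power])
  moreover have "(\<Sum>i = 1..d. c i * r ^ (d - i)) = (\<Sum>i = 1..d. if i = d then - (r ^ d) else 0)"
    by (rule sum.cong) (auto simp: c_def)
  then have "r ^ d + (\<Sum>i = 1..d. c i * r ^ (d - i)) = 0"
    using assms(1) by simp
  ultimately show ?thesis
    unfolding integral_over_ideal_def using assms(1) by blast
qed

lemma normal_ideal_mem_of_power_mem:
  assumes "normal_ideal I" and "d \<ge> 1" and "r ^ d \<in> ideal_power I d"
  shows "r \<in> I"
proof -
  have "ideal_integral_closure I = I"
    using assms(1) ideal_power_one[of I]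
    by (metis normal_ideal_def integrally_closed_ideal_def order_refl)
  then show ?thesis
    using integral_over_ideal_of_power_mem[OF assms(2,3)]
    by (auto simp: ideal_integral_closure_def)
qed


section \<open>Monomial ideals\<close>

lemma monom_xy_mult: "monom_xy i j * monom_xy k l = monom_xy (i + k) (j + l)"
  by (simp add: monom_xy_def mult_single)

lemma monom_xy_power: "monom_xy i j ^ d = monom_xy (d * i) (d * j)"
proof (induction d)
  case 0
  show ?case by (simp add: monom_xy_def flip: zero_prod_def)
qed (simp add: monom_xy_mult)

text \<open>A polynomial in a monomial ideal has all its terms in the ideal, because the polynomials whose
  exponents dominate exponents of generators form an ideal.\<close>
lemma monom_xy_mem_span_imp_dominates:
  assumes "monom_xy p q \<in> ideal.span ((\<lambda>i. monom_xy (a i) (c i)) ` A)"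
  shows "\<exists>i\<in>A. a i \<le> p \<and> c i \<le> q"
proof -
  define J :: "'a poly_xy set"
    where "J = {f. \<forall>k\<in>Poly_Mapping.keys f. \<exists>i\<in>A. a i \<le> fst k \<and> c i \<le> snd k}"
  have "ideal.subspace J"
  proof (rule ideal.subspaceI)
    show "0 \<in> J" by (simp add: J_def)
    show "f + g \<in> J" if "f \<in> J" "g \<in> J" for f g
      using that keys_add[of f g] unfolding J_def by blast
    show "f * g \<in> J" if "g \<in> J" for f g
    proof -
      have "\<exists>i\<in>A. a i \<le> fst k \<and> c i \<le> snd k" if k: "k \<in> Poly_Mapping.keys (f * g)" for k
      proof -
        obtain l m where "k = l + m" and m: "m \<in> Poly_Mapping.keys g"
          using k keys_mult[of f g] by blast
        moreover obtain i where "i \<in> A" "a i \<le> fst m" "c i \<le> snd m"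
          using \<open>g \<in> J\<close> m unfolding J_def by blast
        ultimately show ?thesis by (intro bexI[of _ i]) simp_all
      qed
      then show ?thesis by (simp add: J_def)
    qed
  qed
  moreover have "(\<lambda>i. monom_xy (a i) (c i)) ` A \<subseteq> J"
    by (auto simp: J_def monom_xy_def)
  ultimately have "monom_xy p q \<in> J"
    using assms ideal.span_minimal by blast
  then show ?thesis by (simp add: J_def monom_xy_def)
qed

text \<open>If \<open>d = s + t\<close>, then the \<open>d\<close>-th power of \<open>x\<^sup>py\<^sup>q\<close> is a multiple of a product of \<open>s\<close> copies of the
  generator \<open>i\<close> and \<open>t\<close> copies of the generator \<open>j\<close>.\<close>
lemma normal_monomial_ideal_convex:
  fixes a c :: "'i \<Rightarrow> nat"
  assumes normal: "normal_ideal (ideal.span ((\<lambda>i. monom_xy (a i) (c i) :: 'k::field poly_xy) ` A))"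
    and "i \<in> A" "j \<in> A" "s + t \<ge> 1"
    and p: "s * a i + t * a j \<le> (s + t) * p"
    and q: "s * c i + t * c j \<le> (s + t) * q"
  shows "\<exists>m\<in>A. a m \<le> p \<and> c m \<le> q"
proof -
  let ?g = "\<lambda>i. monom_xy (a i) (c i) :: 'k poly_xy"
  let ?I = "ideal.span (?g ` A)"
  define h :: "'k poly_xy" where
    "h = monom_xy ((s + t) * p - (s * a i + t * a j)) ((s + t) * q - (s * c i + t * c j))"
  have "?g i ^ s * (?g j ^ t * h) \<in> ideal_power ?I (s + (t + 0))"
    using assms(2,3) by (intro power_mult_mem_ideal_power ideal.span_base) auto
  moreover have "?g i ^ s * (?g j ^ t * h) = monom_xy p q ^ (s + t)"
    using p q by (simp add: h_def monom_xy_power monom_xy_mult)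
  ultimately have "monom_xy p q \<in> ?I"
    using normal_ideal_mem_of_power_mem[OF normal \<open>s + t \<ge> 1\<close>, of "monom_xy p q"] by simp
  then show ?thesis by (rule monom_xy_mem_span_imp_dominates)
qed


section \<open>Lattice-convex staircases\<close>

locale convex_staircase =
  fixes n :: nat and a c :: "nat \<Rightarrow> nat"
  assumes run: "strict_antimono_on {1..n} a"
    and rise: "strict_mono_on {1..n} c"
    and convex: "\<And>i j s t p q. \<lbrakk>i \<in> {1..n}; j \<in> {1..n}; s + t \<ge> 1;
        s * a i + t * a j \<le> (s + t) * p; s * c i + t * c j \<le> (s + t) * q\<rbrakk>
      \<Longrightarrow> \<exists>m\<in>{1..n}. a m \<le> p \<and> c m \<le> q"
begin

lemma a_less: "1 \<le> i \<Longrightarrow> i < j \<Longrightarrow> j \<le> n \<Longrightarrow> a j < a i"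
  using monotone_onD[OF run, of i j] by simp

lemma c_less: "1 \<le> i \<Longrightarrow> i < j \<Longrightarrow> j \<le> n \<Longrightarrow> c i < c j"
  using monotone_onD[OF rise, of i j] by simp

lemma a_le_iff: "i \<in> {1..n} \<Longrightarrow> j \<in> {1..n} \<Longrightarrow> a i \<le> a j \<longleftrightarrow> j \<le> i"
  using a_less[of i j] a_less[of j i] by (cases i j rule: linorder_cases) auto

lemma c_le_iff: "i \<in> {1..n} \<Longrightarrow> j \<in> {1..n} \<Longrightarrow> c i \<le> c j \<longleftrightarrow> i \<le> j"
  using c_less[of i j] c_less[of j i] by (cases i j rule: linorder_cases) auto

text \<open>Take the last step \<open>h \<le> j\<close> with a rise of at least two. The rises between \<open>h\<close> and \<open>j\<close> are then
  equal to one, so the segment from the corner \<open>h\<close> to the corner \<open>j + 1\<close> is flat enough not to pass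
  above the lattice point \<open>(a\<^sub>h - 1, c\<^bsub>h+1\<^esub> - 1)\<close>, which dominates no corner.\<close>
lemma rise_eq_Suc_before_long_run:
  assumes j: "j < n" and long: "a (Suc j) + 2 \<le> a j"
    and i: "1 \<le> i" "i \<le> j"
  shows "c (Suc i) = Suc (c i)"
proof (rule ccontr)
  assume "c (Suc i) \<noteq> Suc (c i)"
  define L where "L = {l. 1 \<le> l \<and> l \<le> j \<and> c (Suc l) \<noteq> Suc (c l)}"
  have "finite L" "L \<noteq> {}"
    using i \<open>c (Suc i) \<noteq> Suc (c i)\<close> by (auto simp: L_def)
  define h where "h = Max L"
  have "h \<in> L"
    unfolding h_def using \<open>finite L\<close> \<open>L \<noteq> {}\<close> by (rule Max_in)
  then have h: "1 \<le> h" "h \<le> j" and "c (Suc h) \<noteq> Suc (c h)"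
    by (auto simp: L_def)
  then have tall: "c h + 2 \<le> c (Suc h)"
    using c_less[of h "Suc h"] j by simp
  have unit: "c (Suc l) = Suc (c l)" if "h < l" "l \<le> j" for l
  proof (rule ccontr)
    assume "c (Suc l) \<noteq> Suc (c l)"
    then have "l \<in> L" using that h by (simp add: L_def)
    then show False using Max_ge[OF \<open>finite L\<close>] that by (fastforce simp: h_def)
  qed
  have c_end: "c (Suc (h + e)) = c (Suc h) + e" if "h + e \<le> j" for e
    using that by (induction e) (simp_all add: unit)
  have a_fall: "a (h + e) + e \<le> a h" if "h + e \<le> j" for e
    using that
  proof (induction e)
    case (Suc e)
    then show ?case using a_less[of "h + e" "Suc (h + e)"] h j by simp
  qed simp
  define e where "e = j - h"
  have e: "j = h + e" using h by (simp add: e_def)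
  have ce: "c (Suc j) = c (Suc h) + e" using c_end[of e] e by simp
  have ae: "a (Suc j) + (e + 2) \<le> a h" using a_fall[of e] e long by simp
  \<comment> \<open>The point dividing the segment in the ratio \<open>1 : e + 1\<close> is far enough along it to be at least
    one to the left of the corner \<open>h\<close>: the \<open>e + 1\<close> steps to the corner \<open>j + 1\<close> have total run at
    least \<open>e + 2\<close>, since the last one is long.\<close>
  have "(e + 1) * a h + 1 * a (Suc j) \<le> ((e + 1) + 1) * (a h - 1)"
    using ae by (simp add: diff_mult_distrib2)
  moreover obtain r where r: "c (Suc h) = c h + 2 + r"
    using tall le_Suc_ex by blast
  have "(e + 1) * c h + 1 * c (Suc j) \<le> ((e + 1) + 1) * (c (Suc h) - 1)"
    by (simp add: ce r algebra_simps)
  ultimately obtain m where m: "m \<in> {1..n}" "a m \<le> a h - 1" "c m \<le> c (Suc h) - 1"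
    using convex[of h "Suc j" "e + 1" 1 "a h - 1" "c (Suc h) - 1"] h j by auto
  have "\<not> a h \<le> a m" using m(2) ae by simp
  then have "h < m" using a_le_iff[of h m] m(1) h j by simp
  moreover have "\<not> c (Suc h) \<le> c m" using m(3) tall by simp
  then have "m < Suc h" using c_le_iff[of "Suc h" m] m(1) h j by simp
  ultimately show False by simp
qed

lemma unit_rises_then_unit_runs:
  assumes "n \<ge> 1"
  obtains k where "1 \<le> k" "k \<le> n"
    and "\<And>i. k \<le> i \<Longrightarrow> i < n \<Longrightarrow> a i = Suc (a (Suc i))"
    and "\<And>i. 1 \<le> i \<Longrightarrow> i < k \<Longrightarrow> c (Suc i) = Suc (c i)"
proof
  define L where "L = {j. 1 \<le> j \<and> j < n \<and> a (Suc j) + 2 \<le> a j}"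
  \<comment> \<open>The inserted \<open>0\<close> makes \<open>k = 1\<close> when there is no long run.\<close>
  define k where "k = Suc (Max (insert 0 L))"
  have fin: "finite L" by (simp add: L_def)
  have mem: "Max (insert 0 L) \<in> insert 0 L" using fin by (intro Max_in) auto
  show "1 \<le> k" by (simp add: k_def)
  have "Max (insert 0 L) < n" using mem assms by (auto simp: L_def)
  then show "k \<le> n" by (simp add: k_def)
  show "a i = Suc (a (Suc i))" if "k \<le> i" "i < n" for i
  proof -
    have "i \<notin> L"
    proof
      assume "i \<in> L"
      then have "i \<le> Max (insert 0 L)" using fin by (intro Max_ge) auto
      then show False using that by (simp add: k_def)
    qed
    then show ?thesis
      using a_less[of i "Suc i"] that by (simp add: L_def k_def)
  qed
  show "c (Suc i) = Suc (c i)" if "1 \<le> i" "i < k" for i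
  proof -
    have "k - 1 \<in> L" using mem that unfolding k_def by auto
    then show ?thesis
      using rise_eq_Suc_before_long_run[of "k - 1" i] that by (auto simp: L_def)
  qed
qed

text \<open>The lattice points \<open>(p, c\<^sub>j)\<close> and \<open>(a\<^sub>j, q)\<close> of the next two lemmas dominate the midpoint of the
  two neighbouring corners.\<close>
lemma middle_run_le:
  assumes j: "2 \<le> j" "j < n"
    and "c j = Suc (c (j - 1))" "c (Suc j) = Suc (c j)"
    and p: "a (j - 1) + a (Suc j) \<le> 2 * p"
  shows "a j \<le> p"
proof -
  obtain m where "m \<in> {1..n}" "a m \<le> p" "c m \<le> c j"
    using convex[of "j - 1" "Suc j" 1 1 p "c j"] assms by fastforce
  then show ?thesis
    using c_le_iff[of m j] a_le_iff[of j m] j by auto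
qed

lemma middle_rise_le:
  assumes j: "2 \<le> j" "j < n"
    and "a (j - 1) = Suc (a j)" "a j = Suc (a (Suc j))"
    and q: "c (j - 1) + c (Suc j) \<le> 2 * q"
  shows "c j \<le> q"
proof -
  obtain m where "m \<in> {1..n}" "a m \<le> a j" "c m \<le> q"
    using convex[of "j - 1" "Suc j" 1 1 "a j" q] assms by fastforce
  then show ?thesis
    using a_le_iff[of m j] c_le_iff[of j m] j by auto
qed

end

lemma le_ceiling_half_sum:
  fixes x y z :: nat
  assumes "\<And>p. y + z \<le> 2 * p \<Longrightarrow> x \<le> p"
  shows "int x \<le> \<lceil>(real y + real z) / 2\<rceil>"
proof -
  define m where "m = nat \<lceil>(real y + real z) / 2\<rceil>"
  have "(real y + real z) / 2 \<le> real m"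
    unfolding m_def by (rule real_nat_ceiling_ge)
  then have "real (y + z) \<le> real (2 * m)" by simp
  then have "y + z \<le> 2 * m" by (simp only: of_nat_le_iff)
  then have "x \<le> m" by (rule assms)
  moreover have "int m = \<lceil>(real y + real z) / 2\<rceil>"
    unfolding m_def by (rule nat_0_le) simp
  ultimately show ?thesis by linarith
qed


section \<open>Normal monomial ideals in two variables\<close>

theorem theorem2p13:
  fixes n :: nat
    and a b :: "nat \<Rightarrow> nat"
    and I :: "'k::field poly_xy set"
  assumes "n \<ge> 2"
    and "strict_antimono_on {1..n} a" and "a n = 0"
    and "strict_antimono_on {1..n} b" and "b n = 0"
    and "minimally_generates ((\<lambda>i. monom_xy (a i) (b (n - i + 1))) ` {1..n}) I"
    and "normal_ideal I"
  shows "\<exists>k. 1 \<le> k \<and> k \<le> n \<and>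
    (\<forall>j. k \<le> j \<and> j \<le> n - 1 \<longrightarrow> a j = n - j) \<and>
    (\<forall>j. n - k + 1 \<le> j \<and> j \<le> n - 1 \<longrightarrow> b j = n - j) \<and>
    (\<forall>j. 2 \<le> j \<and> j \<le> n - k \<longrightarrow>
       int (b j) \<le> \<lceil>(real (b (j - 1)) + real (b (j + 1))) / 2\<rceil>) \<and>
    (\<forall>j. 2 \<le> j \<and> j \<le> k - 1 \<longrightarrow>
       int (a j) \<le> \<lceil>(real (a (j - 1)) + real (a (j + 1))) / 2\<rceil>)"
proof -
  note [simp] = \<open>a n = 0\<close> \<open>b n = 0\<close>
  define c where "c i = b (n - i + 1)" for i
  have I: "ideal.span ((\<lambda>i. monom_xy (a i) (c i)) ` {1..n}) = I"
    using assms(6) by (simp add: minimally_generates_def c_def)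
  interpret convex_staircase n a c
  proof
    show "strict_mono_on {1..n} c"
      using monotone_onD[OF assms(4)] by (intro monotone_onI) (auto simp: c_def)
    show "\<exists>m\<in>{1..n}. a m \<le> p \<and> c m \<le> q"
      if "i \<in> {1..n}" "j \<in> {1..n}" "s + t \<ge> 1"
        "s * a i + t * a j \<le> (s + t) * p" "s * c i + t * c j \<le> (s + t) * q" for i j s t p q
      using normal_monomial_ideal_convex[where 'k = 'k, of a c "{1..n}"] assms(7) that
      unfolding I by blast
  qed (fact assms(2))
  have c1: "c 1 = 0" using \<open>n \<ge> 2\<close> by (simp add: c_def)
  have bc: "b j = c (n - j + 1)" if "1 \<le> j" "j \<le> n" for j
    using that by (simp add: c_def)
  have "n \<ge> 1" using \<open>n \<ge> 2\<close> by simp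
  then obtain k where k: "1 \<le> k" "k \<le> n"
    and runs: "\<And>i. k \<le> i \<Longrightarrow> i < n \<Longrightarrow> a i = Suc (a (Suc i))"
    and rises: "\<And>i. 1 \<le> i \<Longrightarrow> i < k \<Longrightarrow> c (Suc i) = Suc (c i)"
    by (rule unit_rises_then_unit_runs) blast
  have a_lin: "a (n - e) = e" if "k \<le> n - e" "e \<le> n" for e
    using that
  proof (induction e)
    case (Suc e)
    then show ?case using runs[of "n - Suc e"] k(1) by (simp add: Suc_diff_Suc)
  qed simp
  have c_lin: "c (Suc e) = e" if "Suc e \<le> k" for e
    using that c1 by (induction e) (simp_all add: rises)
  show ?thesis
  proof (intro exI[of _ k] conjI allI impI)
    show "a j = n - j" if "k \<le> j \<and> j \<le> n - 1" for j
    proof -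
      have "n - (n - j) = j" using that by linarith
      then show ?thesis using a_lin[of "n - j"] that by simp
    qed
    show "b j = n - j" if "n - k + 1 \<le> j \<and> j \<le> n - 1" for j
    proof -
      have "1 \<le> j" "j \<le> n" "Suc (n - j) \<le> k" using that k by linarith+
      then show ?thesis using c_lin[of "n - j"] bc[of j] by simp
    qed
    show "int (b j) \<le> \<lceil>(real (b (j - 1)) + real (b (j + 1))) / 2\<rceil>" if j: "2 \<le> j \<and> j \<le> n - k" for j
    proof (rule le_ceiling_half_sum)
      fix q assume q: "b (j - 1) + b (j + 1) \<le> 2 * q"
      \<comment> \<open>Reading \<open>b\<close> upwards is reading \<open>c\<close> downwards, which exchanges the two neighbours.\<close>
      define i where "i = n - j + 1"
      have i: "2 \<le> i" "i < n" "k \<le> i - 1" using j k by (auto simp: i_def)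
      have nb: "b j = c i" "b (j - 1) = c (Suc i)" "b (j + 1) = c (i - 1)"
      proof -
        have "n - i + 1 = j" "n - Suc i + 1 = j - 1" "n - (i - 1) + 1 = j + 1"
          using j k unfolding i_def by linarith+
        then show "b j = c i" "b (j - 1) = c (Suc i)" "b (j + 1) = c (i - 1)"
          unfolding c_def by simp_all
      qed
      then show "b j \<le> q"
        using middle_rise_le[OF i(1,2), of q] runs[of "i - 1"] runs[of i] i q by simp
    qed
    show "int (a j) \<le> \<lceil>(real (a (j - 1)) + real (a (j + 1))) / 2\<rceil>" if j: "2 \<le> j \<and> j \<le> k - 1" for j
    proof (rule le_ceiling_half_sum)
      fix p assume "a (j - 1) + a (j + 1) \<le> 2 * p"
      moreover have "2 \<le> j" "j < k" "Suc (j - 1) = j" using j by linarith+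
      ultimately show "a j \<le> p"
        using middle_run_le[of j p] rises[of "j - 1"] rises[of j] k by simp
    qed
  qed (use k in auto)
qed

end
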